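(* Let $\mathbb{K}$ be a field of characteristic zero, $R$ a unital commutative associative $\mathbb{K}$-algebra, and let $\langle\cdot,\cdot\rangle\colon L\times N\to R$ be a duality pairing of two $R$-modules $L$ and $N$. Let $(D_0,X_0)\in\mathcal{CDO}(N)$, $y_0\in N$ and $E_0\in\mathrm{End}_{\mathbb{K}}(L)$ be such that the mapping $$L\times L\to R,\quad (\ell_1,\ell_2)\mapsto\langle\ell_1,y_0\rangle\,\langle\ell_2,D_0(y_0)\rangle$$ is symmetric and $$X_0(\langle\ell,n\rangle)=\langle E_0(\ell),n\rangle+\langle\ell,D_0(n)\rangle\quad\text{for all }\ell\in L,\ n\in N.$$ Define the anchor $\rho^L\colon L\to T_R$, $\rho^L(\ell):=\langle\ell,y_0\rangle X_0$. Then the mapping $$\nabla\colon L\to\mathcal{CDO}(L),\quad \nabla(\ell):=(\langle\ell,y_0\rangle E_0,\ \rho^L(\ell))\in\widetilde{\mathcal{CDO}}(L)\times T_R$$ is a well-defined $L$-connection on the anchored module $L$ (with anchor $\rho^L$), and the mapping $$L\times L\to L,\quad(\ell_1,\ell_2)\mapsto\ell_1\cdot\ell_2:=\nabla_{\ell_1}\ell_2=\langle\ell_1,y_0\rangle E_0(\ell_2)$$ defines the structure of a pre-Lie-Rinehart algebra on $L$.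
   Context: $R$-modules are unital left modules. $T_R:=\mathrm{Der}(R)$ is the $R$-module and Lie algebra (under commutators) of all $\mathbb{K}$-linear derivations $R\to R$. A duality pairing of $R$-modules $L,N$ is an $R$-bilinear map $\langle\cdot,\cdot\rangle\colon L\times N\to R$ such that for $\ell\in L$: $\ell=0\iff\langle\ell,N\rangle=\{0\}$, and for $n\in N$: $n=0\iff\langle L,n\rangle=\{0\}$. For an $R$-module $N$ and $r\in R$ let $\mu^N(r)\colon N\to N$, $n\mapsto rn$. Define $\widetilde{\mathcal{CDO}}(N):=\{D\in\mathrm{End}_{\mathbb{K}}(N)\mid[D,\mu^N(R)]\subseteq\mu^N(R)\}$ and $$\mathcal{CDO}(N):=\{(D,X)\in\mathrm{End}_{\mathbb{K}}(N)\times\mathrm{Der}(R)\mid[D,\mu^N(r)]=\mu^N(X(r))\text{ for all }r\in R\},$$ i.e. $D(rn)=rD(n)+X(r)n$ for all $r\in R$, $n\in N$. $\mathcal{CDO}(N)$ is a Lie subalgebra and an $R$-submodule of $\mathrm{End}_{\mathbb{K}}(N)\times\mathrm{Der}(R)$, where $r\cdot(D,X)=(\mu^N(r)D,rX)$; its anchor is $\rho^{\mathcal{CDO}(N)}(D,X):=X$. An anchored module is an $R$-module $L$ with an $R$-linear map $\rho^L\colon L\to T_R$ (anchor). An $L$-connection on an anchored module $L$ is an $R$-linear map $\nabla\colon L\to\mathcal{CDO}(L)$ with $\rho^{\mathcal{CDO}(L)}\circ\nabla=\rho^L$; one writes $\nabla(\ell)=(\nabla_\ell,\rho^L(\ell))$.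 A pre-Lie-Rinehart algebra structure on an anchored module $L$ is an $L$-connection $\nabla\colon L\to\mathcal{CDO}(L)$ such that, with $\ell_1\cdot\ell_2:=\nabla_{\ell_1}\ell_2$ and $[\ell_1,\ell_2]:=\ell_1\cdot\ell_2-\ell_2\cdot\ell_1$: (a) the associator $(\ell_1,\ell_2,\ell_3):=\ell_1\cdot(\ell_2\cdot\ell_3)-(\ell_1\cdot\ell_2)\cdot\ell_3$ satisfies $(\ell_1,\ell_2,\ell_3)=(\ell_2,\ell_1,\ell_3)$ for all $\ell_1,\ell_2,\ell_3\in L$; (b) $\rho^L([\ell_1,\ell_2])=[\rho^L(\ell_1),\rho^L(\ell_2)]$ for all $\ell_1,\ell_2\in L$. *)

theory Defs
  imports "HOL-Algebra.Module"
begin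

definition char_zero :: "('k, 'm) ring_scheme \<Rightarrow> bool" where
  "char_zero K \<longleftrightarrow> (\<forall>n::nat. 0 < n \<longrightarrow> [n] \<cdot>\<^bsub>K\<^esub> \<one>\<^bsub>K\<^esub> \<noteq> \<zero>\<^bsub>K\<^esub>)"

definition linear_maps ::
    "('a, 'm) ring_scheme \<Rightarrow> ('a, 'b, 'p) module_scheme \<Rightarrow> ('a, 'c, 'q) module_scheme \<Rightarrow> ('b \<Rightarrow> 'c) set" where
  "linear_maps A M N = {f \<in> hom (add_monoid M) (add_monoid N).
     \<forall>a\<in>carrier A. \<forall>x\<in>carrier M. f (a \<odot>\<^bsub>M\<^esub> x) = a \<odot>\<^bsub>N\<^esub> f x}"

(* In the module records below that are built from R-modules, only carrier, zero, add and smult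
   matter for the module structure; the ring fields mult and one are mere fillers, except that
   for Der and CDO the field mult holds the Lie bracket. *)

definition restrict_scalars ::
    "('k, 'r, 'm) module_scheme \<Rightarrow> ('r, 'v, 'p) module_scheme \<Rightarrow> ('k, 'v) module" where
  "restrict_scalars R V =
     \<lparr>carrier = carrier V, mult = mult V, one = one V, zero = zero V, add = add V,
      smult = (\<lambda>k v. (k \<odot>\<^bsub>R\<^esub> \<one>\<^bsub>R\<^esub>) \<odot>\<^bsub>V\<^esub> v)\<rparr>"

(* Self-maps of a carrier are taken extensional, so that HOL equality of operators
   is equality of maps on the carrier. *)

definition End ::
    "('k, 's) ring_scheme \<Rightarrow> ('k, 'v, 'm) module_scheme \<Rightarrow> ('v \<Rightarrow> 'v) set" where
  "End K V = linear_maps K V V \<inter> extensional (carrier V)"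

definition commutator ::
    "('v, 'm) ring_scheme \<Rightarrow> ('v \<Rightarrow> 'v) \<Rightarrow> ('v \<Rightarrow> 'v) \<Rightarrow> 'v \<Rightarrow> 'v" where
  "commutator V D D' = (\<lambda>v\<in>carrier V. D (D' v) \<ominus>\<^bsub>V\<^esub> D' (D v))"

definition mu :: "('r, 'v, 'm) module_scheme \<Rightarrow> 'r \<Rightarrow> 'v \<Rightarrow> 'v" where
  "mu V r = (\<lambda>v\<in>carrier V. r \<odot>\<^bsub>V\<^esub> v)"

definition Der ::
    "('k, 's) ring_scheme \<Rightarrow> ('k, 'r, 'm) module_scheme \<Rightarrow> ('r, 'r \<Rightarrow> 'r) module" where
  "Der K R =
     \<lparr>carrier = {X \<in> End K R. \<forall>a\<in>carrier R. \<forall>b\<in>carrier R.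
                   X (a \<otimes>\<^bsub>R\<^esub> b) = a \<otimes>\<^bsub>R\<^esub> X b \<oplus>\<^bsub>R\<^esub> X a \<otimes>\<^bsub>R\<^esub> b},
      mult = commutator R,
      one = undefined,
      zero = (\<lambda>a\<in>carrier R. \<zero>\<^bsub>R\<^esub>),
      add = (\<lambda>X Y. \<lambda>a\<in>carrier R. X a \<oplus>\<^bsub>R\<^esub> Y a),
      smult = (\<lambda>r X. \<lambda>a\<in>carrier R. r \<otimes>\<^bsub>R\<^esub> X a)\<rparr>"

definition CDO_tilde ::
    "('k, 's) ring_scheme \<Rightarrow> ('k, 'r, 'm) module_scheme \<Rightarrow> ('r, 'v, 'p) module_scheme \<Rightarrow>
     ('v \<Rightarrow> 'v) set" where
  "CDO_tilde K R V = {D \<in> End K (restrict_scalars R V).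
     (\<lambda>r. commutator V D (mu V r)) ` carrier R \<subseteq> mu V ` carrier R}"

definition CDO ::
    "('k, 's) ring_scheme \<Rightarrow> ('k, 'r, 'm) module_scheme \<Rightarrow> ('r, 'v, 'p) module_scheme \<Rightarrow>
     ('r, ('v \<Rightarrow> 'v) \<times> ('r \<Rightarrow> 'r)) module" where
  "CDO K R V =
     \<lparr>carrier = {(D, X). D \<in> End K (restrict_scalars R V) \<and> X \<in> carrier (Der K R) \<and>
                   (\<forall>r\<in>carrier R. commutator V D (mu V r) = mu V (X r))},
      mult = (\<lambda>(D, X) (D', X'). (commutator V D D', commutator R X X')),
      one = undefined,
      zero = (\<lambda>v\<in>carrier V. \<zero>\<^bsub>V\<^esub>, \<zero>\<^bsub>Der K R\<^esub>),
      add = (\<lambda>(D, X) (D', X'). (\<lambda>v\<in>carrier V. D v \<oplus>\<^bsub>V\<^esub> D' v, X \<oplus>\<^bsub>Der K R\<^esub> X')),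
      smult = (\<lambda>r (D, X). (compose (carrier V) (mu V r) D, r \<odot>\<^bsub>Der K R\<^esub> X))\<rparr>"

definition duality_pairing ::
    "('r, 'm) ring_scheme \<Rightarrow> ('r, 'l, 'p) module_scheme \<Rightarrow> ('r, 'n, 'q) module_scheme \<Rightarrow>
     ('l \<Rightarrow> 'n \<Rightarrow> 'r) \<Rightarrow> bool" where
  "duality_pairing R L N B \<longleftrightarrow>
     module R L \<and> module R N \<and>
     (\<forall>l\<in>carrier L. \<forall>n\<in>carrier N. B l n \<in> carrier R) \<and>
     (\<forall>l\<in>carrier L. \<forall>l'\<in>carrier L. \<forall>n\<in>carrier N. B (l \<oplus>\<^bsub>L\<^esub> l') n = B l n \<oplus>\<^bsub>R\<^esub> B l' n) \<and>
     (\<forall>r\<in>carrier R. \<forall>l\<in>carrier L. \<forall>n\<in>carrier N. B (r \<odot>\<^bsub>L\<^esub> l) n = r \<otimes>\<^bsub>R\<^esub> B l n) \<and>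
     (\<forall>l\<in>carrier L. \<forall>n\<in>carrier N. \<forall>n'\<in>carrier N. B l (n \<oplus>\<^bsub>N\<^esub> n') = B l n \<oplus>\<^bsub>R\<^esub> B l n') \<and>
     (\<forall>r\<in>carrier R. \<forall>l\<in>carrier L. \<forall>n\<in>carrier N. B l (r \<odot>\<^bsub>N\<^esub> n) = r \<otimes>\<^bsub>R\<^esub> B l n) \<and>
     (\<forall>l\<in>carrier L. l = \<zero>\<^bsub>L\<^esub> \<longleftrightarrow> (\<lambda>n. B l n) ` carrier N = {\<zero>\<^bsub>R\<^esub>}) \<and>
     (\<forall>n\<in>carrier N. n = \<zero>\<^bsub>N\<^esub> \<longleftrightarrow> (\<lambda>l. B l n) ` carrier L = {\<zero>\<^bsub>R\<^esub>})"

definition anchored_module ::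
    "('k, 's) ring_scheme \<Rightarrow> ('k, 'r, 'm) module_scheme \<Rightarrow> ('r, 'l, 'p) module_scheme \<Rightarrow>
     ('l \<Rightarrow> 'r \<Rightarrow> 'r) \<Rightarrow> bool" where
  "anchored_module K R L \<rho> \<longleftrightarrow> module R L \<and> \<rho> \<in> linear_maps R L (Der K R)"

definition L_connection ::
    "('k, 's) ring_scheme \<Rightarrow> ('k, 'r, 'm) module_scheme \<Rightarrow> ('r, 'l, 'p) module_scheme \<Rightarrow>
     ('l \<Rightarrow> 'r \<Rightarrow> 'r) \<Rightarrow> ('l \<Rightarrow> ('l \<Rightarrow> 'l) \<times> ('r \<Rightarrow> 'r)) \<Rightarrow> bool" where
  "L_connection K R L \<rho> nabla \<longleftrightarrow>
     anchored_module K R L \<rho> \<and> nabla \<in> linear_maps R L (CDO K R L) \<and>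
     (\<forall>l\<in>carrier L. snd (nabla l) = \<rho> l)"

definition conn_prod :: "('l \<Rightarrow> ('l \<Rightarrow> 'l) \<times> ('r \<Rightarrow> 'r)) \<Rightarrow> 'l \<Rightarrow> 'l \<Rightarrow> 'l" where
  "conn_prod nabla l l' = fst (nabla l) l'"

definition conn_bracket ::
    "('r, 'l, 'p) module_scheme \<Rightarrow> ('l \<Rightarrow> ('l \<Rightarrow> 'l) \<times> ('r \<Rightarrow> 'r)) \<Rightarrow> 'l \<Rightarrow> 'l \<Rightarrow> 'l" where
  "conn_bracket L nabla l l' = conn_prod nabla l l' \<ominus>\<^bsub>L\<^esub> conn_prod nabla l' l"

definition associator ::
    "('r, 'l, 'p) module_scheme \<Rightarrow> ('l \<Rightarrow> ('l \<Rightarrow> 'l) \<times> ('r \<Rightarrow> 'r)) \<Rightarrow> 'l \<Rightarrow> 'l \<Rightarrow> 'l \<Rightarrow> 'l" where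
  "associator L nabla l1 l2 l3 =
     conn_prod nabla l1 (conn_prod nabla l2 l3) \<ominus>\<^bsub>L\<^esub> conn_prod nabla (conn_prod nabla l1 l2) l3"

definition pre_Lie_Rinehart ::
    "('k, 's) ring_scheme \<Rightarrow> ('k, 'r, 'm) module_scheme \<Rightarrow> ('r, 'l, 'p) module_scheme \<Rightarrow>
     ('l \<Rightarrow> 'r \<Rightarrow> 'r) \<Rightarrow> ('l \<Rightarrow> ('l \<Rightarrow> 'l) \<times> ('r \<Rightarrow> 'r)) \<Rightarrow> bool" where
  "pre_Lie_Rinehart K R L \<rho> nabla \<longleftrightarrow>
     L_connection K R L \<rho> nabla \<and>
     (\<forall>l1\<in>carrier L. \<forall>l2\<in>carrier L. \<forall>l3\<in>carrier L.
        associator L nabla l1 l2 l3 = associator L nabla l2 l1 l3) \<and>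
     (\<forall>l1\<in>carrier L. \<forall>l2\<in>carrier L.
        \<rho> (conn_bracket L nabla l1 l2) = commutator R (\<rho> l1) (\<rho> l2))"

end

theory Submission
  imports Defs
begin

text \<open>
  Write \<open>b l = \<langle>l, y0\<rangle>\<close>, so that \<open>\<nabla> l = b l \<cdot> (E0, X0)\<close>. Three observations prove the theorem.

  First, \<open>-E0\<close> is the transpose of \<open>D0\<close> up to the derivation \<open>X0\<close>. Pairing \<open>E0 (r l)\<close> with an
  arbitrary \<open>n\<close> and using the Leibniz rule for \<open>X0\<close> gives
  \<open>\<langle>E0 (r l), n\<rangle> = r \<langle>E0 l, n\<rangle> + X0 r \<langle>l, n\<rangle>\<close>, and since the pairing separates the points of \<open>L\<close>, the
  pair \<open>(E0, X0)\<close> lies in \<open>CDO L\<close> (\<open>transpose_mem_CDO\<close>).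

  Secondly, \<open>CDO L\<close> and \<open>Der R\<close> are closed under multiplication with elements of \<open>R\<close>
  (\<open>smult_mem_CDO\<close>, \<open>smult_mem_Der\<close>), and the product of an \<open>R\<close>-linear functional with a fixed
  element is an \<open>R\<close>-linear map (\<open>functional_smult_CDO\<close>, \<open>functional_smult_Der\<close>). As \<open>b\<close> is such a
  functional, \<open>\<rho> = b \<cdot> X0\<close> is an anchor and \<open>\<nabla> = b \<cdot> (E0, X0)\<close> is a connection.

  Finally, \<open>X0 (b l) = b (E0 l) + \<langle>l, D0 y0\<rangle>\<close>. Expanding the associator with the Leibniz rule of
  \<open>E0\<close>, the two terms with \<open>b (E0 l2)\<close> cancel and there remains
  \<open>(b l1 * b l2) E0 (E0 l3) + (b l1 * \<langle>l2, D0 y0\<rangle>) E0 l3\<close>. The first summand is symmetric in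
  \<open>l1, l2\<close> because \<open>R\<close> is commutative, the second by the symmetry hypothesis. In the same way
  \<open>[b l1 X0, b l2 X0] = (b l1 * X0 (b l2) - b l2 * X0 (b l1)) X0\<close> differs from the anchor of
  \<open>[l1, l2]\<close> by the antisymmetrization of \<open>b l1 * \<langle>l2, D0 y0\<rangle>\<close> times \<open>X0\<close>, which vanishes.
\<close>

section \<open>Derivations and covariant differential operators\<close>

locale module_over_algebra = alg: algebra K R + module R V
  for K :: "('k, 's) ring_scheme" and R :: "('k, 'r, 'm) module_scheme"
    and V :: "('r, 'v, 'p) module_scheme"

lemma (in abelian_group) minus_eq_iff_eq_add:
  assumes "x \<in> carrier G" "y \<in> carrier G" "z \<in> carrier G"
  shows "x \<ominus> y = z \<longleftrightarrow> x = y \<oplus> z"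
  using assms by (metis a_comm a_minus_def add.inv_solve_right a_inv_closed)

text \<open>
  The anchor and the connection are prescribed on the carrier of \<open>L\<close> only, and elements of
  \<open>linear_maps\<close> need not be extensional.
\<close>

lemma linear_maps_cong:
  assumes "module A M"
    and "f \<in> linear_maps A M N" "\<And>x. x \<in> carrier M \<Longrightarrow> g x = f x"
  shows "g \<in> linear_maps A M N"
proof -
  interpret module A M by fact
  show ?thesis
    using assms(2,3) by (auto simp: linear_maps_def hom_def Pi_iff)
qed

lemma mem_Der_iff:
  "X \<in> carrier (Der K R) \<longleftrightarrow>
     X \<in> extensional (carrier R) \<and> X \<in> carrier R \<rightarrow> carrier R \<and>
     (\<forall>a\<in>carrier R. \<forall>b\<in>carrier R. X (a \<oplus>\<^bsub>R\<^esub> b) = X a \<oplus>\<^bsub>R\<^esub> X b) \<and>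
     (\<forall>k\<in>carrier K. \<forall>a\<in>carrier R. X (k \<odot>\<^bsub>R\<^esub> a) = k \<odot>\<^bsub>R\<^esub> X a) \<and>
     (\<forall>a\<in>carrier R. \<forall>b\<in>carrier R. X (a \<otimes>\<^bsub>R\<^esub> b) = a \<otimes>\<^bsub>R\<^esub> X b \<oplus>\<^bsub>R\<^esub> X a \<otimes>\<^bsub>R\<^esub> b)"
  by (auto simp: Der_def End_def linear_maps_def hom_def)

lemma mem_End_restrict_scalars_iff:
  "D \<in> End K (restrict_scalars R V) \<longleftrightarrow>
     D \<in> extensional (carrier V) \<and> D \<in> carrier V \<rightarrow> carrier V \<and>
     (\<forall>v\<in>carrier V. \<forall>w\<in>carrier V. D (v \<oplus>\<^bsub>V\<^esub> w) = D v \<oplus>\<^bsub>V\<^esub> D w) \<and>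
     (\<forall>k\<in>carrier K. \<forall>v\<in>carrier V.
        D ((k \<odot>\<^bsub>R\<^esub> \<one>\<^bsub>R\<^esub>) \<odot>\<^bsub>V\<^esub> v) = (k \<odot>\<^bsub>R\<^esub> \<one>\<^bsub>R\<^esub>) \<odot>\<^bsub>V\<^esub> D v)"
  by (auto simp: End_def linear_maps_def hom_def restrict_scalars_def)

lemma smult_mem_Der:
  assumes "algebra K R" "r \<in> carrier R" "X \<in> carrier (Der K R)"
  shows "r \<odot>\<^bsub>Der K R\<^esub> X \<in> carrier (Der K R)"
proof -
  interpret alg: algebra K R by fact
  note X = assms(3)[unfolded mem_Der_iff Pi_iff]
  have scale: "r \<otimes>\<^bsub>R\<^esub> (k \<odot>\<^bsub>R\<^esub> a) = k \<odot>\<^bsub>R\<^esub> (r \<otimes>\<^bsub>R\<^esub> a)" if "k \<in> carrier K" "a \<in> carrier R" for k a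
    using assms(2) that by (metis alg.m_comm alg.smult_assoc2 alg.smult_closed)
  show ?thesis
    unfolding mem_Der_iff using X assms(2)
    by (auto simp: Der_def scale alg.r_distr alg.m_assoc alg.m_lcomm)
qed

text \<open>
  Both sides of the commutator condition are extensional, so it can be checked at each \<open>v\<close> and
  solved there for \<open>D (r v)\<close>. All later computations use this Leibniz form.
\<close>

lemma (in module_over_algebra) mem_CDO_iff:
  "(D, X) \<in> carrier (CDO K R V) \<longleftrightarrow>
     D \<in> End K (restrict_scalars R V) \<and> X \<in> carrier (Der K R) \<and>
     (\<forall>r\<in>carrier R. \<forall>v\<in>carrier V. D (r \<odot>\<^bsub>V\<^esub> v) = r \<odot>\<^bsub>V\<^esub> D v \<oplus>\<^bsub>V\<^esub> X r \<odot>\<^bsub>V\<^esub> v)"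
proof -
  have "commutator V D (mu V r) = mu V (X r) \<longleftrightarrow>
          (\<forall>v\<in>carrier V. D (r \<odot>\<^bsub>V\<^esub> v) = r \<odot>\<^bsub>V\<^esub> D v \<oplus>\<^bsub>V\<^esub> X r \<odot>\<^bsub>V\<^esub> v)"
    if D: "D \<in> End K (restrict_scalars R V)" and X: "X \<in> carrier (Der K R)" and r: "r \<in> carrier R"
    for r
  proof -
    have [simp]: "v \<in> carrier V \<Longrightarrow> D v \<in> carrier V" for v
      using D by (auto simp: mem_End_restrict_scalars_iff)
    have [simp]: "X r \<in> carrier R"
      using X r by (auto simp: mem_Der_iff)
    have "commutator V D (mu V r) = mu V (X r) \<longleftrightarrow>
            (\<forall>v\<in>carrier V. D (r \<odot>\<^bsub>V\<^esub> v) \<ominus>\<^bsub>V\<^esub> r \<odot>\<^bsub>V\<^esub> D v = X r \<odot>\<^bsub>V\<^esub> v)"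
      using r by (auto simp: commutator_def mu_def restrict_def fun_eq_iff)
    also have "\<dots> \<longleftrightarrow>
            (\<forall>v\<in>carrier V. D (r \<odot>\<^bsub>V\<^esub> v) = r \<odot>\<^bsub>V\<^esub> D v \<oplus>\<^bsub>V\<^esub> X r \<odot>\<^bsub>V\<^esub> v)"
      using r by (simp add: M.minus_eq_iff_eq_add)
    finally show ?thesis .
  qed
  then show ?thesis
    by (auto simp: CDO_def)
qed

lemma smult_CDO:
  "r \<odot>\<^bsub>CDO K R V\<^esub> (D, X) = (compose (carrier V) (mu V r) D, r \<odot>\<^bsub>Der K R\<^esub> X)"
  by (simp add: CDO_def)

lemma CDO_subset_CDO_tilde_times_Der:
  "carrier (CDO K R V) \<subseteq> CDO_tilde K R V \<times> carrier (Der K R)"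
  by (auto simp: CDO_def CDO_tilde_def mem_Der_iff)

lemma (in module_over_algebra) smult_smult_commute:
  assumes "r \<in> carrier R" "s \<in> carrier R" "v \<in> carrier V"
  shows "r \<odot>\<^bsub>V\<^esub> (s \<odot>\<^bsub>V\<^esub> v) = s \<odot>\<^bsub>V\<^esub> (r \<odot>\<^bsub>V\<^esub> v)"
  using assms by (metis alg.m_comm smult_assoc1)

text \<open>
  Multiplication by \<open>r\<close> commutes with multiplication by every other scalar, as \<open>R\<close> is commutative; so
  the multiple of \<open>D\<close> is again \<open>K\<close>-linear and its Leibniz rule is \<open>r\<close> times that of \<open>D\<close>.
\<close>

lemma (in module_over_algebra) smult_mem_CDO:
  assumes r: "r \<in> carrier R" and DX: "P \<in> carrier (CDO K R V)"
  shows "r \<odot>\<^bsub>CDO K R V\<^esub> P \<in> carrier (CDO K R V)"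
proof -
  obtain D X where P: "P = (D, X)"
    by fastforce
  have D: "D \<in> End K (restrict_scalars R V)" and X: "X \<in> carrier (Der K R)"
    and leibniz: "\<And>s v. s \<in> carrier R \<Longrightarrow> v \<in> carrier V \<Longrightarrow>
      D (s \<odot>\<^bsub>V\<^esub> v) = s \<odot>\<^bsub>V\<^esub> D v \<oplus>\<^bsub>V\<^esub> X s \<odot>\<^bsub>V\<^esub> v"
    using DX by (auto simp: P mem_CDO_iff)
  note D' = D[unfolded mem_End_restrict_scalars_iff Pi_iff] and X' = X[unfolded mem_Der_iff Pi_iff]
  have "compose (carrier V) (mu V r) D \<in> End K (restrict_scalars R V)"
    unfolding mem_End_restrict_scalars_iff using D' r
    by (auto simp: compose_def mu_def smult_r_distr smult_smult_commute)
  moreover have "r \<odot>\<^bsub>Der K R\<^esub> X \<in> carrier (Der K R)"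
    using alg.algebra_axioms r X by (rule smult_mem_Der)
  moreover have "compose (carrier V) (mu V r) D (s \<odot>\<^bsub>V\<^esub> v) =
      s \<odot>\<^bsub>V\<^esub> compose (carrier V) (mu V r) D v \<oplus>\<^bsub>V\<^esub> (r \<odot>\<^bsub>Der K R\<^esub> X) s \<odot>\<^bsub>V\<^esub> v"
    if "s \<in> carrier R" "v \<in> carrier V" for s v
    using that D' X' r
    by (simp add: compose_def mu_def Der_def leibniz smult_r_distr smult_assoc1 smult_smult_commute)
  ultimately show ?thesis
    by (simp add: P smult_CDO mem_CDO_iff)
qed

section \<open>Multiples of a fixed element by a linear functional\<close>

text \<open>
  The record \<open>R\<close> carries the scalar multiplication of \<open>K\<close>, not the one of \<open>R\<close> on itself. So
  \<open>R\<close>-linearity of a functional \<open>\<phi>\<close> is spelled out with the ring multiplication instead of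
  \<open>linear_maps\<close>.
\<close>

lemma functional_smult_Der:
  assumes "algebra K R" "module R W"
    and \<phi>: "\<And>w. w \<in> carrier W \<Longrightarrow> \<phi> w \<in> carrier R"
    and add: "\<And>w w'. w \<in> carrier W \<Longrightarrow> w' \<in> carrier W \<Longrightarrow> \<phi> (w \<oplus>\<^bsub>W\<^esub> w') = \<phi> w \<oplus>\<^bsub>R\<^esub> \<phi> w'"
    and smult: "\<And>r w. r \<in> carrier R \<Longrightarrow> w \<in> carrier W \<Longrightarrow> \<phi> (r \<odot>\<^bsub>W\<^esub> w) = r \<otimes>\<^bsub>R\<^esub> \<phi> w"
    and X: "X \<in> carrier (Der K R)"
  shows "(\<lambda>w. \<phi> w \<odot>\<^bsub>Der K R\<^esub> X) \<in> linear_maps R W (Der K R)"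
proof -
  interpret alg: algebra K R by fact
  interpret W: module R W by fact
  have [simp]: "a \<in> carrier R \<Longrightarrow> X a \<in> carrier R" for a
    using X by (auto simp: mem_Der_iff)
  have "\<phi> (w \<oplus>\<^bsub>W\<^esub> w') \<odot>\<^bsub>Der K R\<^esub> X = \<phi> w \<odot>\<^bsub>Der K R\<^esub> X \<oplus>\<^bsub>Der K R\<^esub> \<phi> w' \<odot>\<^bsub>Der K R\<^esub> X"
    if "w \<in> carrier W" "w' \<in> carrier W" for w w'
    using that by (auto simp: Der_def fun_eq_iff add \<phi> alg.l_distr)
  moreover have "\<phi> (r \<odot>\<^bsub>W\<^esub> w) \<odot>\<^bsub>Der K R\<^esub> X = r \<odot>\<^bsub>Der K R\<^esub> (\<phi> w \<odot>\<^bsub>Der K R\<^esub> X)"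
    if "r \<in> carrier R" "w \<in> carrier W" for r w
    using that by (auto simp: Der_def fun_eq_iff smult \<phi> alg.m_assoc)
  ultimately show ?thesis
    by (simp add: linear_maps_def hom_def smult_mem_Der[OF assms(1) _ X] \<phi>)
qed

lemma (in module_over_algebra) functional_smult_CDO:
  assumes W: "module R W"
    and \<phi>: "\<And>w. w \<in> carrier W \<Longrightarrow> \<phi> w \<in> carrier R"
    and add: "\<And>w w'. w \<in> carrier W \<Longrightarrow> w' \<in> carrier W \<Longrightarrow> \<phi> (w \<oplus>\<^bsub>W\<^esub> w') = \<phi> w \<oplus>\<^bsub>R\<^esub> \<phi> w'"
    and smult: "\<And>r w. r \<in> carrier R \<Longrightarrow> w \<in> carrier W \<Longrightarrow> \<phi> (r \<odot>\<^bsub>W\<^esub> w) = r \<otimes>\<^bsub>R\<^esub> \<phi> w"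
    and P: "P \<in> carrier (CDO K R V)"
  shows "(\<lambda>w. \<phi> w \<odot>\<^bsub>CDO K R V\<^esub> P) \<in> linear_maps R W (CDO K R V)"
proof -
  interpret W: module R W by fact
  obtain D X where DX: "P = (D, X)"
    by fastforce
  have [simp]: "v \<in> carrier V \<Longrightarrow> D v \<in> carrier V" for v
    using P by (auto simp: DX mem_CDO_iff mem_End_restrict_scalars_iff)
  have "X \<in> carrier (Der K R)"
    using P by (simp add: DX mem_CDO_iff)
  from functional_smult_Der[OF alg.algebra_axioms W \<phi> add smult this]
  have lin: "(\<lambda>w. \<phi> w \<odot>\<^bsub>Der K R\<^esub> X) \<in> linear_maps R W (Der K R)" .
  have "\<phi> (w \<oplus>\<^bsub>W\<^esub> w') \<odot>\<^bsub>CDO K R V\<^esub> P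
          = \<phi> w \<odot>\<^bsub>CDO K R V\<^esub> P \<oplus>\<^bsub>CDO K R V\<^esub> \<phi> w' \<odot>\<^bsub>CDO K R V\<^esub> P"
    if "w \<in> carrier W" "w' \<in> carrier W" for w w'
    using that lin
    by (auto simp: DX CDO_def linear_maps_def hom_def fun_eq_iff compose_def mu_def add \<phi> smult_l_distr)
  moreover have "\<phi> (r \<odot>\<^bsub>W\<^esub> w) \<odot>\<^bsub>CDO K R V\<^esub> P = r \<odot>\<^bsub>CDO K R V\<^esub> (\<phi> w \<odot>\<^bsub>CDO K R V\<^esub> P)"
    if "r \<in> carrier R" "w \<in> carrier W" for r w
    using that lin
    by (auto simp: DX CDO_def linear_maps_def fun_eq_iff compose_def mu_def smult \<phi> smult_assoc1)
  ultimately show ?thesis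
    by (simp add: linear_maps_def hom_def smult_mem_CDO P \<phi>)
qed

section \<open>Transposes along a duality pairing\<close>

lemma duality_pairing_separates:
  assumes "duality_pairing R L N B" "l \<in> carrier L" "l' \<in> carrier L"
    and eq: "\<And>n. n \<in> carrier N \<Longrightarrow> B l n = B l' n"
  shows "l = l'"
proof -
  interpret L: module R L
    using assms(1) by (simp add: duality_pairing_def)
  interpret N: module R N
    using assms(1) by (simp add: duality_pairing_def)
  note pairing = assms(1)[unfolded duality_pairing_def]
  have minus: "\<ominus>\<^bsub>L\<^esub> l' = (\<ominus>\<^bsub>R\<^esub> \<one>\<^bsub>R\<^esub>) \<odot>\<^bsub>L\<^esub> l'"
    using assms(3) by (simp add: L.smult_l_minus)
  have "B (l \<ominus>\<^bsub>L\<^esub> l') n = \<zero>\<^bsub>R\<^esub>" if "n \<in> carrier N" for n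
  proof -
    have "B (l \<ominus>\<^bsub>L\<^esub> l') n = B l n \<oplus>\<^bsub>R\<^esub> (\<ominus>\<^bsub>R\<^esub> \<one>\<^bsub>R\<^esub>) \<otimes>\<^bsub>R\<^esub> B l' n"
      using pairing assms(2,3) that by (simp add: a_minus_def minus)
    also have "\<dots> = \<zero>\<^bsub>R\<^esub>"
      using pairing assms(2,3) that by (simp add: eq L.R.l_minus L.R.r_neg)
    finally show ?thesis .
  qed
  \<comment> \<open>The image is all of the singleton because the carrier of \<open>N\<close> contains zero.\<close>
  then have "(\<lambda>n. B (l \<ominus>\<^bsub>L\<^esub> l') n) ` carrier N = {\<zero>\<^bsub>R\<^esub>}"
    using N.M.zero_closed by force
  then have "l \<ominus>\<^bsub>L\<^esub> l' = \<zero>\<^bsub>L\<^esub>"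
    using pairing assms(2,3) by blast
  then show ?thesis
    using assms(2,3) by (simp add: L.M.minus_eq_iff_eq_add)
qed

text \<open>
  The Leibniz rule may be tested after pairing with all \<open>n\<close>, where it turns into the Leibniz rule of
  \<open>X\<close> for the product \<open>r * \<langle>l, n\<rangle>\<close>.
\<close>

lemma transpose_mem_CDO:
  assumes alg: "algebra K R" and pairing: "duality_pairing R L N B"
    and X: "X \<in> carrier (Der K R)" and D: "D \<in> carrier N \<rightarrow> carrier N"
    and E: "E \<in> End K (restrict_scalars R L)"
    and transpose: "\<And>l n. l \<in> carrier L \<Longrightarrow> n \<in> carrier N \<Longrightarrow>
      X (B l n) = B (E l) n \<oplus>\<^bsub>R\<^esub> B l (D n)"
  shows "(E, X) \<in> carrier (CDO K R L)"
proof -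
  interpret alg: algebra K R by fact
  interpret L: module R L
    using pairing by (simp add: duality_pairing_def)
  interpret L: module_over_algebra K R L ..
  note B = pairing[unfolded duality_pairing_def]
  have Xc [simp]: "\<And>a. a \<in> carrier R \<Longrightarrow> X a \<in> carrier R"
    using X by (auto simp: mem_Der_iff)
  have [simp]: "\<And>l. l \<in> carrier L \<Longrightarrow> E l \<in> carrier L" "\<And>n. n \<in> carrier N \<Longrightarrow> D n \<in> carrier N"
    using E D by (auto simp: mem_End_restrict_scalars_iff)
  have [simp]: "\<And>l n. l \<in> carrier L \<Longrightarrow> n \<in> carrier N \<Longrightarrow> B l n \<in> carrier R"
    using B by blast
  have "E (r \<odot>\<^bsub>L\<^esub> l) = r \<odot>\<^bsub>L\<^esub> E l \<oplus>\<^bsub>L\<^esub> X r \<odot>\<^bsub>L\<^esub> l" if r: "r \<in> carrier R" and l: "l \<in> carrier L" for r l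
  proof (rule duality_pairing_separates[OF pairing])
    fix n assume n: "n \<in> carrier N"
    have "B (E (r \<odot>\<^bsub>L\<^esub> l)) n \<oplus>\<^bsub>R\<^esub> r \<otimes>\<^bsub>R\<^esub> B l (D n) = X (r \<otimes>\<^bsub>R\<^esub> B l n)"
      using transpose[of "r \<odot>\<^bsub>L\<^esub> l" n] B r l n by simp
    also have "\<dots> = r \<otimes>\<^bsub>R\<^esub> X (B l n) \<oplus>\<^bsub>R\<^esub> X r \<otimes>\<^bsub>R\<^esub> B l n"
      using X r l n by (simp add: mem_Der_iff)
    also have "\<dots> = (r \<otimes>\<^bsub>R\<^esub> B (E l) n \<oplus>\<^bsub>R\<^esub> X r \<otimes>\<^bsub>R\<^esub> B l n) \<oplus>\<^bsub>R\<^esub> r \<otimes>\<^bsub>R\<^esub> B l (D n)"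
      using r l n by (simp add: transpose alg.r_distr alg.a_ac)
    finally have "B (E (r \<odot>\<^bsub>L\<^esub> l)) n = r \<otimes>\<^bsub>R\<^esub> B (E l) n \<oplus>\<^bsub>R\<^esub> X r \<otimes>\<^bsub>R\<^esub> B l n"
      using r l n by (simp add: alg.add.right_cancel)
    also have "\<dots> = B (r \<odot>\<^bsub>L\<^esub> E l \<oplus>\<^bsub>L\<^esub> X r \<odot>\<^bsub>L\<^esub> l) n"
      using B r l n by simp
    finally show "B (E (r \<odot>\<^bsub>L\<^esub> l)) n = B (r \<odot>\<^bsub>L\<^esub> E l \<oplus>\<^bsub>L\<^esub> X r \<odot>\<^bsub>L\<^esub> l) n" .
  qed (use r l in simp_all)
  with X E show ?thesis
    by (simp add: L.mem_CDO_iff)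
qed

section \<open>The product defined by a functional and an operator\<close>

text \<open>
  The function \<open>c = X \<circ> b - b \<circ> E\<close> measures the failure of \<open>b\<close> to intertwine \<open>E\<close> and \<open>X\<close>; for
  \<open>b = \<langle>_, y0\<rangle>\<close> and \<open>E = E0\<close> it is \<open>\<langle>_, D0 y0\<rangle>\<close>. The symmetry of the associator in its
  first two arguments is thereby reduced to the symmetry of \<open>b u * c v\<close>.
\<close>

lemma (in module_over_algebra) associator_functional_operator:
  assumes EX: "(E, X) \<in> carrier (CDO K R V)"
    and b: "\<And>v. v \<in> carrier V \<Longrightarrow> b v \<in> carrier R"
    and b_smult: "\<And>r v. r \<in> carrier R \<Longrightarrow> v \<in> carrier V \<Longrightarrow> b (r \<odot>\<^bsub>V\<^esub> v) = r \<otimes>\<^bsub>R\<^esub> b v"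
    and c: "\<And>v. v \<in> carrier V \<Longrightarrow> c v \<in> carrier R"
    and defect: "\<And>v. v \<in> carrier V \<Longrightarrow> X (b v) = b (E v) \<oplus>\<^bsub>R\<^esub> c v"
    and prod: "\<And>v w. v \<in> carrier V \<Longrightarrow> w \<in> carrier V \<Longrightarrow> conn_prod nabla v w = b v \<odot>\<^bsub>V\<^esub> E w"
    and u: "u \<in> carrier V" and v: "v \<in> carrier V" and w: "w \<in> carrier V"
  shows "associator V nabla u v w =
    (b u \<otimes>\<^bsub>R\<^esub> b v) \<odot>\<^bsub>V\<^esub> E (E w) \<oplus>\<^bsub>V\<^esub> (b u \<otimes>\<^bsub>R\<^esub> c v) \<odot>\<^bsub>V\<^esub> E w"
proof -
  have [simp]: "x \<in> carrier V \<Longrightarrow> E x \<in> carrier V" for x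
    using EX by (auto simp: mem_CDO_iff mem_End_restrict_scalars_iff)
  have leibniz: "E (r \<odot>\<^bsub>V\<^esub> x) = r \<odot>\<^bsub>V\<^esub> E x \<oplus>\<^bsub>V\<^esub> X r \<odot>\<^bsub>V\<^esub> x" if "r \<in> carrier R" "x \<in> carrier V" for r x
    using EX that by (simp add: mem_CDO_iff)
  have "conn_prod nabla u (conn_prod nabla v w) =
      b u \<odot>\<^bsub>V\<^esub> (b v \<odot>\<^bsub>V\<^esub> E (E w) \<oplus>\<^bsub>V\<^esub> (b (E v) \<oplus>\<^bsub>R\<^esub> c v) \<odot>\<^bsub>V\<^esub> E w)"
    using u v w by (simp add: prod b leibniz defect)
  \<comment> \<open>The first summand is the product \<open>(u \<cdot> v) \<cdot> w\<close>, which the associator subtracts.\<close>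
  also have "\<dots> = (b u \<otimes>\<^bsub>R\<^esub> b (E v)) \<odot>\<^bsub>V\<^esub> E w \<oplus>\<^bsub>V\<^esub>
      ((b u \<otimes>\<^bsub>R\<^esub> b v) \<odot>\<^bsub>V\<^esub> E (E w) \<oplus>\<^bsub>V\<^esub> (b u \<otimes>\<^bsub>R\<^esub> c v) \<odot>\<^bsub>V\<^esub> E w)"
    using u v w by (simp add: b c smult_l_distr smult_r_distr smult_assoc1 M.a_ac)
  finally have "conn_prod nabla u (conn_prod nabla v w) = \<dots>" .
  moreover have "conn_prod nabla (conn_prod nabla u v) w = (b u \<otimes>\<^bsub>R\<^esub> b (E v)) \<odot>\<^bsub>V\<^esub> E w"
    using u v w by (simp add: prod b b_smult)
  ultimately show ?thesis
    using u v w by (simp add: associator_def M.minus_eq_iff_eq_add b c)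
qed

text \<open>The second-order terms \<open>r s X (X a)\<close> of the two compositions cancel.\<close>

lemma commutator_smult_Der:
  assumes "algebra K R" "X \<in> carrier (Der K R)" "r \<in> carrier R" "s \<in> carrier R"
  shows "commutator R (r \<odot>\<^bsub>Der K R\<^esub> X) (s \<odot>\<^bsub>Der K R\<^esub> X) =
    (r \<otimes>\<^bsub>R\<^esub> X s \<ominus>\<^bsub>R\<^esub> s \<otimes>\<^bsub>R\<^esub> X r) \<odot>\<^bsub>Der K R\<^esub> X"
proof -
  interpret alg: algebra K R by fact
  have [simp]: "a \<in> carrier R \<Longrightarrow> X a \<in> carrier R" for a
    using assms(2) by (auto simp: mem_Der_iff)
  have leibniz: "X (a \<otimes>\<^bsub>R\<^esub> b) = a \<otimes>\<^bsub>R\<^esub> X b \<oplus>\<^bsub>R\<^esub> X a \<otimes>\<^bsub>R\<^esub> b" if "a \<in> carrier R" "b \<in> carrier R" for a b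
    using assms(2) that by (simp add: mem_Der_iff)
  have ring_identity: "r \<otimes>\<^bsub>R\<^esub> (s \<otimes>\<^bsub>R\<^esub> z \<oplus>\<^bsub>R\<^esub> p \<otimes>\<^bsub>R\<^esub> x) \<ominus>\<^bsub>R\<^esub> s \<otimes>\<^bsub>R\<^esub> (r \<otimes>\<^bsub>R\<^esub> z \<oplus>\<^bsub>R\<^esub> q \<otimes>\<^bsub>R\<^esub> x) =
      (r \<otimes>\<^bsub>R\<^esub> p \<ominus>\<^bsub>R\<^esub> s \<otimes>\<^bsub>R\<^esub> q) \<otimes>\<^bsub>R\<^esub> x"
    if "x \<in> carrier R" "z \<in> carrier R" "p \<in> carrier R" "q \<in> carrier R" for x z p q
    using assms(3,4) that by algebra
  have "commutator R (r \<odot>\<^bsub>Der K R\<^esub> X) (s \<odot>\<^bsub>Der K R\<^esub> X) a =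
      ((r \<otimes>\<^bsub>R\<^esub> X s \<ominus>\<^bsub>R\<^esub> s \<otimes>\<^bsub>R\<^esub> X r) \<odot>\<^bsub>Der K R\<^esub> X) a" for a
    using assms(3,4) by (cases "a \<in> carrier R") (simp_all add: commutator_def Der_def leibniz ring_identity)
  then show ?thesis
    by blast
qed

section \<open>The pre-Lie-Rinehart structure\<close>

theorem theorem4p8:
  fixes K :: "('k, 's) ring_scheme"
    and R :: "('k, 'r, 'm) module_scheme"
    and L :: "('r, 'l, 'p) module_scheme"
    and N :: "('r, 'n, 'q) module_scheme"
    and B :: "'l \<Rightarrow> 'n \<Rightarrow> 'r"
    and D0 :: "'n \<Rightarrow> 'n" and X0 :: "'r \<Rightarrow> 'r" and y0 :: 'n and E0 :: "'l \<Rightarrow> 'l"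
    and \<rho> :: "'l \<Rightarrow> 'r \<Rightarrow> 'r"
    and nabla :: "'l \<Rightarrow> ('l \<Rightarrow> 'l) \<times> ('r \<Rightarrow> 'r)"
  assumes "field K" and "char_zero K"
    and "algebra K R"
    and "duality_pairing R L N B"
    and "(D0, X0) \<in> carrier (CDO K R N)"
    and "y0 \<in> carrier N"
    and "E0 \<in> End K (restrict_scalars R L)"
    and "\<forall>l1\<in>carrier L. \<forall>l2\<in>carrier L.
           B l1 y0 \<otimes>\<^bsub>R\<^esub> B l2 (D0 y0) = B l2 y0 \<otimes>\<^bsub>R\<^esub> B l1 (D0 y0)"
    and "\<forall>l\<in>carrier L. \<forall>n\<in>carrier N. X0 (B l n) = B (E0 l) n \<oplus>\<^bsub>R\<^esub> B l (D0 n)"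
    and "\<forall>l\<in>carrier L. \<rho> l = B l y0 \<odot>\<^bsub>Der K R\<^esub> X0"
    and "\<forall>l\<in>carrier L. nabla l = (compose (carrier L) (mu L (B l y0)) E0, \<rho> l)"
  shows "anchored_module K R L \<rho> \<and>
         (\<forall>l\<in>carrier L. nabla l \<in> CDO_tilde K R L \<times> carrier (Der K R)) \<and>
         (\<forall>l\<in>carrier L. nabla l \<in> carrier (CDO K R L)) \<and>
         L_connection K R L \<rho> nabla \<and>
         (\<forall>l1\<in>carrier L. \<forall>l2\<in>carrier L. conn_prod nabla l1 l2 = B l1 y0 \<odot>\<^bsub>L\<^esub> E0 l2) \<and>
         pre_Lie_Rinehart K R L \<rho> nabla"
proof -
  interpret alg: algebra K R by fact
  have modL: "module R L" and modN: "module R N"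
    using assms(4) by (simp_all add: duality_pairing_def)
  interpret L: module R L by (rule modL)
  interpret L: module_over_algebra K R L ..
  interpret N: module R N by (rule modN)
  interpret N: module_over_algebra K R N ..
  note pairing = assms(4)[unfolded duality_pairing_def]
  have X0: "X0 \<in> carrier (Der K R)" and D0: "D0 \<in> carrier N \<rightarrow> carrier N"
    using assms(5) by (auto simp: N.mem_CDO_iff mem_End_restrict_scalars_iff)
  have E0 [simp]: "l \<in> carrier L \<Longrightarrow> E0 l \<in> carrier L" for l
    using assms(7) by (auto simp: mem_End_restrict_scalars_iff)
  define b where "b l = B l y0" for l
  define c where "c l = B l (D0 y0)" for l
  have b [simp]: "l \<in> carrier L \<Longrightarrow> b l \<in> carrier R" for l
    using pairing assms(6) by (simp add: b_def)
  have c [simp]: "l \<in> carrier L \<Longrightarrow> c l \<in> carrier R" for l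
    using pairing assms(6) D0 by (auto simp: c_def)
  have b_add: "b (l \<oplus>\<^bsub>L\<^esub> l') = b l \<oplus>\<^bsub>R\<^esub> b l'" if "l \<in> carrier L" "l' \<in> carrier L" for l l'
    using pairing assms(6) that by (simp add: b_def)
  have b_smult: "b (r \<odot>\<^bsub>L\<^esub> l) = r \<otimes>\<^bsub>R\<^esub> b l" if "r \<in> carrier R" "l \<in> carrier L" for r l
    using pairing assms(6) that by (simp add: b_def)
  have defect: "X0 (b l) = b (E0 l) \<oplus>\<^bsub>R\<^esub> c l" if "l \<in> carrier L" for l
    using assms(6,9) that by (simp add: b_def c_def)
  have symm: "b l \<otimes>\<^bsub>R\<^esub> c l' = b l' \<otimes>\<^bsub>R\<^esub> c l" if "l \<in> carrier L" "l' \<in> carrier L" for l l'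
    using assms(8) that by (simp add: b_def c_def)
  have rho: "\<rho> l = b l \<odot>\<^bsub>Der K R\<^esub> X0" if "l \<in> carrier L" for l
    using assms(10) that by (simp add: b_def)
  have nabla: "nabla l = b l \<odot>\<^bsub>CDO K R L\<^esub> (E0, X0)" if "l \<in> carrier L" for l
    using assms(11) that by (simp add: b_def smult_CDO rho)

  have CDO_L: "(E0, X0) \<in> carrier (CDO K R L)"
    by (rule transpose_mem_CDO[OF assms(3,4) X0 D0 assms(7)]) (use assms(9) in simp)
  have anchored: "anchored_module K R L \<rho>"
    unfolding anchored_module_def
    using linear_maps_cong[OF modL functional_smult_Der[OF assms(3) modL b b_add b_smult X0] rho] modL
    by simp
  have nabla_CDO: "nabla l \<in> carrier (CDO K R L)" if "l \<in> carrier L" for l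
    using that L.smult_mem_CDO[OF b CDO_L] by (simp add: nabla)
  have connection: "L_connection K R L \<rho> nabla"
    unfolding L_connection_def
    using anchored linear_maps_cong[OF modL L.functional_smult_CDO[OF modL b b_add b_smult CDO_L] nabla]
    by (simp add: nabla smult_CDO rho)
  have prod: "conn_prod nabla l l' = b l \<odot>\<^bsub>L\<^esub> E0 l'" if "l \<in> carrier L" "l' \<in> carrier L" for l l'
    using that by (simp add: conn_prod_def nabla smult_CDO compose_def mu_def)

  note assoc = L.associator_functional_operator[OF CDO_L b b_smult c defect prod]
  have "associator L nabla l1 l2 l3 = associator L nabla l2 l1 l3"
    if "l1 \<in> carrier L" "l2 \<in> carrier L" "l3 \<in> carrier L" for l1 l2 l3
    using that by (simp add: assoc symm[of l1 l2] alg.m_comm[of "b l1" "b l2"])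
  moreover have "\<rho> (conn_bracket L nabla l1 l2) = commutator R (\<rho> l1) (\<rho> l2)"
    if l: "l1 \<in> carrier L" "l2 \<in> carrier L" for l1 l2
  proof -
    have "b (conn_bracket L nabla l1 l2) = b (b l1 \<odot>\<^bsub>L\<^esub> E0 l2 \<oplus>\<^bsub>L\<^esub> (\<ominus>\<^bsub>R\<^esub> b l2) \<odot>\<^bsub>L\<^esub> E0 l1)"
      using l by (simp add: conn_bracket_def prod a_minus_def L.smult_l_minus)
    also have "\<dots> = b l1 \<otimes>\<^bsub>R\<^esub> b (E0 l2) \<ominus>\<^bsub>R\<^esub> b l2 \<otimes>\<^bsub>R\<^esub> b (E0 l1)"
      using l by (simp add: b_add b_smult a_minus_def alg.l_minus)
    \<comment> \<open>Adding \<open>b l1 * c l2 = b l2 * c l1\<close> to both terms turns \<open>b (E0 l)\<close> into \<open>X0 (b l)\<close>.\<close>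
    also have "\<dots> = (b l1 \<otimes>\<^bsub>R\<^esub> b (E0 l2) \<oplus>\<^bsub>R\<^esub> b l1 \<otimes>\<^bsub>R\<^esub> c l2) \<ominus>\<^bsub>R\<^esub>
        (b l2 \<otimes>\<^bsub>R\<^esub> b (E0 l1) \<oplus>\<^bsub>R\<^esub> b l1 \<otimes>\<^bsub>R\<^esub> c l2)"
    proof -
      have "p \<ominus>\<^bsub>R\<^esub> q = (p \<oplus>\<^bsub>R\<^esub> d) \<ominus>\<^bsub>R\<^esub> (q \<oplus>\<^bsub>R\<^esub> d)"
        if "p \<in> carrier R" "q \<in> carrier R" "d \<in> carrier R" for p q d
        using that by algebra
      then show ?thesis
        using l by simp
    qed
    also have "\<dots> = b l1 \<otimes>\<^bsub>R\<^esub> X0 (b l2) \<ominus>\<^bsub>R\<^esub> b l2 \<otimes>\<^bsub>R\<^esub> X0 (b l1)"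
      using l by (simp add: defect alg.r_distr symm[of l2 l1])
    finally have "b (conn_bracket L nabla l1 l2) = \<dots>" .
    moreover have "conn_bracket L nabla l1 l2 \<in> carrier L"
      using l by (simp add: conn_bracket_def prod)
    ultimately show ?thesis
      using l by (simp add: rho commutator_smult_Der[OF assms(3) X0])
  qed
  ultimately have "pre_Lie_Rinehart K R L \<rho> nabla"
    using connection by (simp add: pre_Lie_Rinehart_def)
  moreover have "\<forall>l\<in>carrier L. nabla l \<in> CDO_tilde K R L \<times> carrier (Der K R)"
    using nabla_CDO CDO_subset_CDO_tilde_times_Der by blast
  ultimately show ?thesis
    using anchored connection nabla_CDO prod by (simp add: b_def)
qed

end
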